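(* Suppose that a sequence of collective preference relations $\{\succsim_t\}_{t=0}^\infty$ over dated aggregate consumption $(\hat x,t)$ is represented by the separable utility function $\tilde\beta_t\,\tilde U(\hat x)$, where $$\tilde U(\hat x)=\frac{\gamma}{1-\gamma}\left[\left(\hat\phi+\frac{\eta}{\gamma}\hat x\right)^{1-\gamma}-1\right]\ (\gamma\ne1),\qquad \tilde U(\hat x)=\log(\hat\phi+\eta\hat x)\ (\gamma=1),$$ and $$\tilde\beta_t=\left(\sum_{i=1}^n\tilde\theta_0^i(\tilde\delta^i)^t\right)^{\gamma},\qquad t=0,1,\dots .$$ Assume $\theta_0^i>0$ for each $i\in\{1,\dots,n\}$. Then the collective time preferences 1. are nonstationary (they do not satisfy Stationarity), 2. are time dependent (they do not satisfy Time invariance), 3. are time consistent (they satisfy Time consistency).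
   Context: Parameters: $n\ge2$; discount factors $1>\delta^1>\delta^2\ge\cdots\ge\delta^n>0$; $0<\gamma<\infty$, $0<\eta<\infty$, $\hat\phi\in\mathbb{R}$; initial weights $\theta_0=(\theta_0^1,\dots,\theta_0^n)$ with $\theta_0^i\ge0$, $\sum_i\theta_0^i=1$. Effective quantities: $\tilde\theta_0^i=(\theta_0^i)^{1/\gamma}/\sum_j(\theta_0^j)^{1/\gamma}$ and $\tilde\delta^i=(\delta^i)^{1/\gamma}$. Times and delays $t,t',\tau,\tau'$ are nonnegative integers; consumption levels $b,c$ are real numbers in the domain of $\tilde U$, i.e. $\hat\phi+(\eta/\gamma)b>0$ and $\hat\phi+(\eta/\gamma)c>0$. Representation: discounting from date $s$ to date $t$ is multiplication by $\tilde\beta_s/\tilde\beta_t$, so the indifference relation $\sim_t$ of $\succsim_t$ is given by $$(b,s)\sim_t(c,s')\iff \frac{\tilde\beta_s}{\tilde\beta_t}\tilde U(b)=\frac{\tilde\beta_{s'}}{\tilde\beta_t}\tilde U(c).$$ The three properties, each required for every $t,t'\ge0$, every $b,c$ and every $\tau,\tau'\ge0$: - Stationarity: $(b,t+\tau)\sim_t(c,t+\tau')\iff(b,t'+\tau)\sim_t(c,t'+\tau')$. - Time invariance: $(b,t+\tau)\sim_t(c,t+\tau')\iff(b,t'+\tau)\sim_{t'}(c,t'+\tau')$. - Time consistency: $(b,t+\tau)\sim_t(c,t+\tau')\iff(b,t+\tau)\sim_{t'}(c,t+\tau')$. *)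

theory Defs
  imports Complex_Main
begin

definition eff_weight :: "nat \<Rightarrow> real \<Rightarrow> (nat \<Rightarrow> real) \<Rightarrow> nat \<Rightarrow> real" where
  "eff_weight n \<gamma> \<theta> i = \<theta> i powr (1 / \<gamma>) / (\<Sum>j = 1..n. \<theta> j powr (1 / \<gamma>))"

definition eff_discount :: "real \<Rightarrow> (nat \<Rightarrow> real) \<Rightarrow> nat \<Rightarrow> real" where
  "eff_discount \<gamma> \<delta> i = \<delta> i powr (1 / \<gamma>)"

definition collective_discount ::
  "nat \<Rightarrow> real \<Rightarrow> (nat \<Rightarrow> real) \<Rightarrow> (nat \<Rightarrow> real) \<Rightarrow> nat \<Rightarrow> real" where
  "collective_discount n \<gamma> \<theta> \<delta> t =
     (\<Sum>i = 1..n. eff_weight n \<gamma> \<theta> i * eff_discount \<gamma> \<delta> i ^ t) powr \<gamma>"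

definition utility_domain :: "real \<Rightarrow> real \<Rightarrow> real \<Rightarrow> real set" where
  "utility_domain \<gamma> \<eta> \<phi> = {x. \<phi> + \<eta> / \<gamma> * x > 0}"

definition collective_utility :: "real \<Rightarrow> real \<Rightarrow> real \<Rightarrow> real \<Rightarrow> real" where
  "collective_utility \<gamma> \<eta> \<phi> x =
     (if \<gamma> = 1 then ln (\<phi> + \<eta> * x)
      else \<gamma> / (1 - \<gamma>) * ((\<phi> + \<eta> / \<gamma> * x) powr (1 - \<gamma>) - 1))"

text \<open>A dated consumption is a pair of a consumption level and the calendar date at which it is
  received. A sequence \<open>P\<close> of preference relations has as \<open>P t\<close> the weak preference held
  at date \<open>t\<close>: \<open>P t x y\<close> reads ``\<open>x\<close> is at least as good as \<open>y\<close>''.\<close>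

type_synonym dated = "real \<times> nat"

definition indifferent :: "(dated \<Rightarrow> dated \<Rightarrow> bool) \<Rightarrow> dated \<Rightarrow> dated \<Rightarrow> bool" where
  "indifferent R x y \<longleftrightarrow> R x y \<and> R y x"

text \<open>Separable representation on the consumption set \<open>X\<close>: at date \<open>t\<close>, consumption at date
  \<open>s\<close> is discounted by \<open>\<beta> s / \<beta> t\<close>. The date \<open>s\<close> may precede \<open>t\<close>.\<close>

definition represented_by ::
  "real set \<Rightarrow> (nat \<Rightarrow> dated \<Rightarrow> dated \<Rightarrow> bool) \<Rightarrow> (nat \<Rightarrow> real) \<Rightarrow> (real \<Rightarrow> real) \<Rightarrow> bool" where
  "represented_by X P \<beta> U \<longleftrightarrow>
     (\<forall>t s s'. \<forall>b\<in>X. \<forall>c\<in>X.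
        P t (b, s) (c, s') \<longleftrightarrow> \<beta> s / \<beta> t * U b \<ge> \<beta> s' / \<beta> t * U c)"

definition stationarity :: "real set \<Rightarrow> (nat \<Rightarrow> dated \<Rightarrow> dated \<Rightarrow> bool) \<Rightarrow> bool" where
  "stationarity X P \<longleftrightarrow>
     (\<forall>t t' \<tau> \<tau>'. \<forall>b\<in>X. \<forall>c\<in>X.
        indifferent (P t) (b, t + \<tau>) (c, t + \<tau>') \<longleftrightarrow>
        indifferent (P t) (b, t' + \<tau>) (c, t' + \<tau>'))"

definition time_invariance :: "real set \<Rightarrow> (nat \<Rightarrow> dated \<Rightarrow> dated \<Rightarrow> bool) \<Rightarrow> bool" where
  "time_invariance X P \<longleftrightarrow>
     (\<forall>t t' \<tau> \<tau>'. \<forall>b\<in>X. \<forall>c\<in>X.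
        indifferent (P t) (b, t + \<tau>) (c, t + \<tau>') \<longleftrightarrow>
        indifferent (P t') (b, t' + \<tau>) (c, t' + \<tau>'))"

definition time_consistency :: "real set \<Rightarrow> (nat \<Rightarrow> dated \<Rightarrow> dated \<Rightarrow> bool) \<Rightarrow> bool" where
  "time_consistency X P \<longleftrightarrow>
     (\<forall>t t' \<tau> \<tau>'. \<forall>b\<in>X. \<forall>c\<in>X.
        indifferent (P t) (b, t + \<tau>) (c, t + \<tau>') \<longleftrightarrow>
        indifferent (P t') (b, t + \<tau>) (c, t + \<tau>'))"

end

(* The weighted sum S t of the powers of the effective discount factors satisfies
   S 1 ^ 2 < S 0 * S 2 by the strict Cauchy-Schwarz inequality, because two of the factors differ.
   Hence the discount function, a positive power of S, has \<beta> 1 / \<beta> 0 < \<beta> 2 / \<beta> 1.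
   An indifference between (b, 1) and (c, 0) with U b \<noteq> 0 fixes U c / U b = \<beta> 1 / \<beta> 0, and
   so it cannot persist when both dates are postponed by one period. Such b and c exist by the
   intermediate value theorem. Time consistency holds because the evaluation date t enters
   only through the common factor 1 / \<beta> t. *)
theory Submission
  imports Defs
begin

text \<open>This is positivity of a weighted variance. With S0, S1, S2 the moments of order 0, 1, 2,
  the sum of \<open>w k * (d k * S0 - S1)\<^sup>2\<close> equals S0 * (S0 * S2 - S1^2). Scaling the
  deviation from the mean S1 / S0 by S0 avoids division.\<close>

lemma strict_Cauchy_Schwarz_moments:
  fixes w d :: "'a \<Rightarrow> real"
  assumes "finite I" and w: "\<And>i. i \<in> I \<Longrightarrow> w i > 0"
    and "i \<in> I" "j \<in> I" "d i \<noteq> d j"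
  shows "(\<Sum>k\<in>I. w k * d k)\<^sup>2 < (\<Sum>k\<in>I. w k) * (\<Sum>k\<in>I. w k * (d k)\<^sup>2)"
proof -
  define S0 S1 S2 where "S0 = (\<Sum>k\<in>I. w k)" and "S1 = (\<Sum>k\<in>I. w k * d k)"
    and "S2 = (\<Sum>k\<in>I. w k * (d k)\<^sup>2)"
  have S0: "S0 > 0"
    unfolding S0_def using assms by (intro sum_pos) auto
  \<comment> \<open>Two distinct values of \<open>d\<close> cannot both equal the mean, so some
    deviation is nonzero.\<close>
  obtain k where k: "k \<in> I" "d k * S0 - S1 \<noteq> 0"
  proof -
    have "d i * S0 \<noteq> d j * S0" using S0 assms by simp
    then show ?thesis using that \<open>i \<in> I\<close> \<open>j \<in> I\<close> by (metis eq_iff_diff_eq_0)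
  qed
  have "0 < (\<Sum>k\<in>I. w k * (d k * S0 - S1)\<^sup>2)"
    using \<open>finite I\<close> k w by (intro sum_pos2[of _ k]) (auto simp: less_imp_le)
  also have "\<dots> = (\<Sum>k\<in>I. S0\<^sup>2 * (w k * (d k)\<^sup>2) - 2 * S0 * S1 * (w k * d k) + S1\<^sup>2 * w k)"
    by (intro sum.cong refl) (simp add: power2_eq_square algebra_simps)
  also have "\<dots> = S0\<^sup>2 * S2 - 2 * S0 * S1 * S1 + S1\<^sup>2 * S0"
    by (simp add: sum.distrib sum_subtractf flip: sum_distrib_left S0_def S1_def S2_def)
  also have "\<dots> = S0 * (S0 * S2 - S1\<^sup>2)"
    by (simp add: power2_eq_square algebra_simps)
  finally show ?thesis
    using S0 by (simp add: zero_less_mult_iff S0_def S1_def S2_def)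
qed

lemma indifferent_iff:
  assumes "represented_by X P \<beta> U" "\<beta> t > 0" "b \<in> X" "c \<in> X"
  shows "indifferent (P t) (b, s) (c, s') \<longleftrightarrow> \<beta> s * U b = \<beta> s' * U c"
proof -
  have "indifferent (P t) (b, s) (c, s') \<longleftrightarrow> \<beta> s / \<beta> t * U b = \<beta> s' / \<beta> t * U c"
    using assms(1,3,4) unfolding represented_by_def indifferent_def by (metis order_class.order_eq_iff)
  then show ?thesis using assms(2) by simp
qed

lemma represented_by_time_consistency:
  assumes "represented_by X P \<beta> U" "\<And>t. \<beta> t > 0"
  shows "time_consistency X P"
  unfolding time_consistency_def using assms by (simp add: indifferent_iff)

text \<open>One pair of consumption levels refutes both properties, with t = 0, t' = 1, \<tau> = 1
  and \<tau>' = 0.\<close>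

lemma represented_by_not_stationarity_time_invariance:
  assumes "represented_by X P \<beta> U" "\<And>t. \<beta> t > 0"
    and "b \<in> X" "c \<in> X" "U b \<noteq> 0" "U c = \<beta> 1 / \<beta> 0 * U b" "(\<beta> 1)\<^sup>2 \<noteq> \<beta> 0 * \<beta> 2"
  shows "\<not> stationarity X P" "\<not> time_invariance X P"
proof -
  note indiff = indifferent_iff[OF assms(1,2,3,4)]
  have \<beta>0: "\<beta> 0 \<noteq> 0" using assms(2)[of 0] by simp
  \<comment> \<open>The evaluation date stays arbitrary in \<open>now\<close> and
    \<open>later\<close>: stationarity compares the two pairs under the same relation, time
    invariance under \<open>P 0\<close> and \<open>P 1\<close>. The unsimplified sums match the
    shape t + \<tau> of the definitions.\<close>
  have now: "indifferent (P t) (b, 0 + 1) (c, 0 + 0)" for t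
    using \<beta>0 assms(6) by (simp add: indiff)
  have later: "\<not> indifferent (P t) (b, 1 + 1) (c, 1 + 0)" for t
  proof
    assume "indifferent (P t) (b, 1 + 1) (c, 1 + 0)"
    then have "\<beta> 2 * U b = \<beta> 1 * (\<beta> 1 / \<beta> 0 * U b)"
      using assms(6) by (simp add: indiff numeral_2_eq_2)
    then show False
      using assms(5,7) \<beta>0 by (simp add: field_simps power2_eq_square)
  qed
  show "\<not> stationarity X P"
    unfolding stationarity_def using now later assms(3,4) by blast
  show "\<not> time_invariance X P"
    unfolding time_invariance_def using now later assms(3,4) by blast
qed

text \<open>Utility vanishes where its argument is 1 and is positive where it is 2, so every
  fraction \<open>r\<close> of the latter value is attained in between.\<close>

lemma collective_utility_intermediate:
  assumes "\<gamma> > 0" "\<eta> > 0" "0 \<le> r" "r \<le> 1"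
  shows "\<exists>b\<in>utility_domain \<gamma> \<eta> \<phi>. \<exists>c\<in>utility_domain \<gamma> \<eta> \<phi>.
    collective_utility \<gamma> \<eta> \<phi> b \<noteq> 0 \<and>
    collective_utility \<gamma> \<eta> \<phi> c = r * collective_utility \<gamma> \<eta> \<phi> b"
proof -
  let ?U = "collective_utility \<gamma> \<eta> \<phi>"
  \<comment> \<open>The levels at which the argument of the utility function equals 1 and 2.\<close>
  define a b where "a = (1 - \<phi>) * \<gamma> / \<eta>" and "b = (2 - \<phi>) * \<gamma> / \<eta>"
  have a: "\<phi> + \<eta> / \<gamma> * a = 1" and b: "\<phi> + \<eta> / \<gamma> * b = 2"
    using assms by (simp_all add: a_def b_def)
  have "a \<le> b"
    using assms by (simp add: a_def b_def divide_right_mono)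
  have ge1: "\<phi> + \<eta> / \<gamma> * x \<ge> 1" if "a \<le> x" for x
  proof -
    have "\<eta> / \<gamma> * a \<le> \<eta> / \<gamma> * x"
      using that assms by (intro mult_left_mono) auto
    then show ?thesis using a by linarith
  qed
  have Ua: "?U a = 0"
    using a by (cases "\<gamma> = 1") (simp_all add: collective_utility_def)
  \<comment> \<open>For \<gamma> \<noteq> 1 the factor \<gamma> / (1 - \<gamma>) and the bracket
    have the same sign: both positive if \<gamma> < 1, both negative if \<gamma> > 1.\<close>
  have Ub: "?U b > 0"
  proof (cases \<gamma> "1::real" rule: linorder_cases)
    case less
    then have "(2::real) powr (1 - \<gamma>) > 1" by simp
    then show ?thesis using less \<open>\<gamma> > 0\<close> b by (simp add: collective_utility_def)
  next
    case equal
    then show ?thesis using b by (simp add: collective_utility_def)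
  next
    case greater
    then have "(2::real) powr (1 - \<gamma>) < 2 powr 0"
      by (intro powr_less_mono) auto
    then show ?thesis
      using greater b by (simp add: collective_utility_def mult_pos_neg divide_neg_neg)
  qed
  \<comment> \<open>By \<open>ge1\<close> the argument stays away from 0, where \<open>ln\<close>
    and \<open>powr\<close> may fail to be continuous.\<close>
  have "continuous_on {a..b} ?U"
  proof (cases "\<gamma> = 1")
    case True
    have "\<phi> + \<eta> * x \<noteq> 0" if "x \<in> {a..b}" for x
      using ge1[of x] that True by auto
    then show ?thesis
      unfolding collective_utility_def using True by (auto intro!: continuous_intros)
  next
    case False
    have "\<phi> + \<eta> / \<gamma> * x \<noteq> 0" if "x \<in> {a..b}" for x
      using ge1[of x] that by auto
    then show ?thesis
      unfolding collective_utility_def using False \<open>\<gamma> > 0\<close> by (auto intro!: continuous_intros)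
  qed
  then obtain c where c: "a \<le> c" "?U c = r * ?U b"
    using IVT'[of ?U a "r * ?U b" b] \<open>a \<le> b\<close> Ua Ub assms(3,4)
    by (auto simp: mult_left_le_one_le)
  have "b \<in> utility_domain \<gamma> \<eta> \<phi>" "c \<in> utility_domain \<gamma> \<eta> \<phi>"
    using ge1[OF \<open>a \<le> b\<close>] ge1[OF c(1)] by (auto simp: utility_domain_def)
  then show ?thesis using c Ub by force
qed

theorem theorem4p3:
  fixes n :: nat
    and \<delta> \<theta> :: "nat \<Rightarrow> real"
    and \<gamma> \<eta> \<phi> :: real
    and P :: "nat \<Rightarrow> dated \<Rightarrow> dated \<Rightarrow> bool"
  assumes "n \<ge> 2"
    and "1 > \<delta> 1" and "\<delta> 1 > \<delta> 2"
    and "\<forall>i j. 2 \<le> i \<and> i \<le> j \<and> j \<le> n \<longrightarrow> \<delta> i \<ge> \<delta> j"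
    and "\<delta> n > 0"
    and "\<gamma> > 0" and "\<eta> > 0"
    and "(\<Sum>i = 1..n. \<theta> i) = 1"
    and "\<forall>i\<in>{1..n}. \<theta> i > 0"
    and "represented_by (utility_domain \<gamma> \<eta> \<phi>) P
           (collective_discount n \<gamma> \<theta> \<delta>) (collective_utility \<gamma> \<eta> \<phi>)"
  shows "\<not> stationarity (utility_domain \<gamma> \<eta> \<phi>) P
       \<and> \<not> time_invariance (utility_domain \<gamma> \<eta> \<phi>) P
       \<and> time_consistency (utility_domain \<gamma> \<eta> \<phi>) P"
proof -
  let ?\<beta> = "collective_discount n \<gamma> \<theta> \<delta>"
  let ?w = "eff_weight n \<gamma> \<theta>"
  let ?d = "eff_discount \<gamma> \<delta>"
  define S where "S t = (\<Sum>i = 1..n. ?w i * ?d i ^ t)" for t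
  \<comment> \<open>For i \<ge> 2 the chain is 0 < \<delta> n \<le> \<delta> i \<le> \<delta> 2 <
    \<delta> 1 < 1; for i = 1 its outer members suffice.\<close>
  have \<delta>: "0 < \<delta> i" "\<delta> i < 1" if "i \<in> {1..n}" for i
  proof -
    have "i = 1 \<or> 2 \<le> i" using that by auto
    moreover have "\<delta> i \<ge> \<delta> n" "\<delta> 2 \<ge> \<delta> i" if "2 \<le> i"
      using assms(4) \<open>i \<in> {1..n}\<close> that by auto
    moreover have "\<delta> 2 \<ge> \<delta> n" using assms(1,4) by auto
    ultimately show "0 < \<delta> i" "\<delta> i < 1" using assms(2,3,5) by force+
  qed
  have "\<theta> i powr (1 / \<gamma>) > 0" if "i \<in> {1..n}" for i
    using assms(9) that by (metis less_irrefl powr_gt_zero)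
  then have w: "?w i > 0" if "i \<in> {1..n}" for i
    unfolding eff_weight_def using that by (intro divide_pos_pos sum_pos) auto
  have d: "?d i > 0" "?d i < 1" if "i \<in> {1..n}" for i
    using \<delta>[OF that] powr_less_mono2[of "1 / \<gamma>" "\<delta> i" 1] \<open>\<gamma> > 0\<close>
    by (simp_all add: eff_discount_def)
  have S_pos: "S t > 0" for t
    unfolding S_def using w d assms(1) by (intro sum_pos) auto
  have \<beta>: "?\<beta> t = S t powr \<gamma>" for t
    by (simp add: collective_discount_def S_def)
  have \<beta>_pos: "?\<beta> t > 0" for t
    using S_pos[of t] by (simp add: \<beta>)
  \<comment> \<open>This puts the ratio of the first two discount values in [0, 1], as the
    intermediate value argument requires.\<close>
  have "S 1 \<le> S 0"
    unfolding S_def using w d by (intro sum_mono) (auto simp: less_imp_le)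
  then have "?\<beta> 1 \<le> ?\<beta> 0"
    unfolding \<beta> using S_pos[of 1] \<open>\<gamma> > 0\<close> by (intro powr_mono2) auto
  have "?d 1 \<noteq> ?d 2"
    using powr_less_mono2[of "1 / \<gamma>" "\<delta> 2" "\<delta> 1"] \<delta>(1)[of 2] assms(1,3) \<open>\<gamma> > 0\<close>
    by (simp add: eff_discount_def)
  then have "(S 1)\<^sup>2 < S 0 * S 2"
    using strict_Cauchy_Schwarz_moments[of "{1..n}" ?w 1 2 ?d] w assms(1) by (simp add: S_def)
  \<comment> \<open>The power \<gamma> is strictly increasing and multiplicative on nonnegative
    reals, so the strict inequality passes from \<open>S\<close> to the discount function.\<close>
  then have "((S 1)\<^sup>2) powr \<gamma> < (S 0 * S 2) powr \<gamma>"
    using \<open>\<gamma> > 0\<close> by (intro powr_less_mono2) auto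
  then have "(?\<beta> 1)\<^sup>2 \<noteq> ?\<beta> 0 * ?\<beta> 2"
    by (simp add: \<beta> power2_eq_square powr_mult)
  moreover obtain b c where "b \<in> utility_domain \<gamma> \<eta> \<phi>" "c \<in> utility_domain \<gamma> \<eta> \<phi>"
    "collective_utility \<gamma> \<eta> \<phi> b \<noteq> 0"
    "collective_utility \<gamma> \<eta> \<phi> c = ?\<beta> 1 / ?\<beta> 0 * collective_utility \<gamma> \<eta> \<phi> b"
    using collective_utility_intermediate[of \<gamma> \<eta> "?\<beta> 1 / ?\<beta> 0" \<phi>]
      \<open>?\<beta> 1 \<le> ?\<beta> 0\<close> \<beta>_pos[of 0] \<beta>_pos[of 1] \<open>\<gamma> > 0\<close> \<open>\<eta> > 0\<close> by auto
  ultimately show ?thesis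
    using represented_by_not_stationarity_time_invariance[OF assms(10) \<beta>_pos]
      represented_by_time_consistency[OF assms(10) \<beta>_pos] by blast
qed

end
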